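(* Let $\Gamma$ be a finite group and $S\subset\Gamma$ a generating set with $s\in S\Rightarrow s^{-1}\in S$ and identity $e\notin S$, and let $\Gamma(\Gamma,S)$ be the Cayley graph with vertex set $\Gamma$ and edges $\{g,g\circ s\}$ for $g\in\Gamma$, $s\in S$. Let $L$ be its (unweighted) Laplacian, $\lambda_2$ its second smallest and $\lambda_n$ its largest eigenvalue ($n=|\Gamma|$). If there exist eigenvectors $\phi_2,\phi_n:\Gamma\to\mathbb{R}$ of $L$ for $\lambda_2,\lambda_n$ respectively such that for each $\phi\in\{\phi_2,\phi_n\}$ the quantity $\sum_{g\in\Gamma}\phi(g)\phi(g\circ s)$ is independent of $s\in S$, then $\Gamma(\Gamma,S)$ is conformally rigid.
   Context: For a finite simple connected graph $G=(V,E)$, $|V|=n$, and edge weights $w:E\to\mathbb{R}_{\ge 0}$, the weighted Laplacian $L_w$ has $(L_w)_{ij}=-w_{ij}$ if $ij\in E$, $(L_w)_{ii}=\sum_{j\sim i}w_{ij}$, and $0$ otherwise; its eigenvalues are $0=\lambda_1(w)\le\lambda_2(w)\le\dots\le\lambda_n(w)$. Let $\mathbbm{1}$ denote the all-ones weight (so $L=L_{\mathbbm{1}}$). $G$ is conformally rigid if for all $w,w':E\to\mathbb{R}_{\ge0}$ with $\sum_{e}w_e=\sum_{e}w'_e=|E|$ one has $\lambda_2(w)\le\lambda_2(\mathbbm{1})\le\lambda_n(\mathbbm{1})\le\lambda_n(w')$. *)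

theory Defs
  imports
    "HOL-Algebra.Generated_Groups"
    "Jordan_Normal_Form.Char_Poly"
begin

text \<open>Graphs are given by a vertex set \<open>V\<close> and a set \<open>E\<close> of two-element edges. Edge weights are
  total functions on \<open>'a set\<close>; only their values on \<open>E\<close> are ever used.\<close>

definition simple_connected_graph :: "'a set \<Rightarrow> 'a set set \<Rightarrow> bool" where
  "simple_connected_graph V E \<longleftrightarrow>
     finite V \<and> V \<noteq> {} \<and> (\<forall>e\<in>E. e \<subseteq> V \<and> card e = 2) \<and>
     (\<forall>u\<in>V. \<forall>v\<in>V. (u, v) \<in> {(x, y). {x, y} \<in> E}\<^sup>*)"

definition laplacian :: "'a set \<Rightarrow> 'a set set \<Rightarrow> ('a set \<Rightarrow> real) \<Rightarrow> 'a \<Rightarrow> 'a \<Rightarrow> real" where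
  "laplacian V E w u v =
     (if u = v then (\<Sum>x | x \<in> V \<and> {u, x} \<in> E. w {u, x})
      else if {u, v} \<in> E then - w {u, v}
      else 0)"

definition enum_mat :: "'a list \<Rightarrow> ('a \<Rightarrow> 'a \<Rightarrow> real) \<Rightarrow> real mat" where
  "enum_mat xs A = mat (length xs) (length xs) (\<lambda>(i, j). A (xs ! i) (xs ! j))"

definition vertex_list :: "'a set \<Rightarrow> 'a list" where
  "vertex_list V = (SOME xs. distinct xs \<and> set xs = V)"

text \<open>The choice made by \<^const>\<open>vertex_list\<close> is immaterial for the characteristic polynomial.\<close>

lemma char_poly_enum_mat_unique:
  assumes "distinct xs" "distinct ys" "set xs = set ys"
  shows "char_poly (enum_mat xs A) = char_poly (enum_mat ys A)"
proof -
  define n where "n = length xs"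
  have len: "length xs = n" "length ys = n"
    using assms distinct_card[of xs] distinct_card[of ys] by (auto simp: n_def)
  define P where "P = mat n n (\<lambda>(i, j). if xs ! i = ys ! j then 1 else (0::real))"
  define Q where "Q = mat n n (\<lambda>(i, j). if ys ! i = xs ! j then 1 else (0::real))"
  have sum_pick: "(\<Sum>k = 0..<n. f (zs ! k) * (if zs ! k = z then 1 else (0::real))) = f z"
    if zs: "distinct zs" "length zs = n" "z \<in> set zs" for zs :: "'a list" and z f
  proof -
    obtain m where m: "m < n" "z = zs ! m" using zs by (auto simp: in_set_conv_nth)
    have "(\<Sum>k = 0..<n. f (zs ! k) * (if zs ! k = z then 1 else 0)) =
          (\<Sum>k = 0..<n. if k = m then f z else 0)"
      using zs m by (intro sum.cong) (auto simp: nth_eq_iff_index_eq)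
    then show ?thesis using m by simp
  qed
  have mem_xs: "xs ! i \<in> set xs" "ys ! i \<in> set ys" if "i < n" for i
    using that len by (auto intro: nth_mem)
  have mem: "xs ! i \<in> set ys" "ys ! i \<in> set xs" if "i < n" for i
    using mem_xs[OF that] assms(3) by blast+
  have P: "P \<in> carrier_mat n n" and Q: "Q \<in> carrier_mat n n" by (auto simp: P_def Q_def)
  have Ax: "enum_mat xs A \<in> carrier_mat n n" and Ay: "enum_mat ys A \<in> carrier_mat n n"
    by (auto simp: enum_mat_def len)
  have PQ: "P * Q = 1\<^sub>m n"
  proof (rule eq_matI)
    fix i j assume "i < dim_row (1\<^sub>m n :: real mat)" "j < dim_col (1\<^sub>m n :: real mat)"
    then have ij: "i < n" "j < n" by auto
    have "(P * Q) $$ (i, j) = (\<Sum>k = 0..<n. (\<lambda>y. if xs ! i = y then 1 else 0) (ys ! k) *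
        (if ys ! k = xs ! j then 1 else 0))"
      using ij P Q by (simp add: scalar_prod_def) (simp add: P_def Q_def)
    also have "\<dots> = (if xs ! i = xs ! j then 1 else 0)"
      using ij by (intro sum_pick) (auto simp: assms(1,2) len mem)
    finally show "(P * Q) $$ (i, j) = 1\<^sub>m n $$ (i, j)"
      using ij assms by (simp add: nth_eq_iff_index_eq len)
  qed (use P Q in auto)
  have QP: "Q * P = 1\<^sub>m n" using mat_mult_left_right_inverse[OF P Q PQ] .
  have AP: "enum_mat xs A * P = P * enum_mat ys A"
  proof (rule eq_matI)
    fix i j assume "i < dim_row (P * enum_mat ys A)" "j < dim_col (P * enum_mat ys A)"
    then have ij: "i < n" "j < n" using P Ay by auto
    have "(enum_mat xs A * P) $$ (i, j) =
        (\<Sum>k = 0..<n. A (xs ! i) (xs ! k) * (if xs ! k = ys ! j then 1 else 0))"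
      using ij P Ax by (simp add: scalar_prod_def) (simp add: P_def enum_mat_def len)
    also have "\<dots> = A (xs ! i) (ys ! j)"
      using ij by (intro sum_pick) (auto simp: assms(1,2) len mem)
    also have "\<dots> = (\<Sum>k = 0..<n. A (ys ! k) (ys ! j) * (if ys ! k = xs ! i then 1 else 0))"
      using ij by (intro sum_pick[symmetric]) (auto simp: assms(1,2) len mem)
    also have "\<dots> = (P * enum_mat ys A) $$ (i, j)"
      using ij P Ay
      by (simp add: scalar_prod_def) (auto simp: P_def enum_mat_def len intro!: sum.cong)
    finally show "(enum_mat xs A * P) $$ (i, j) = (P * enum_mat ys A) $$ (i, j)" .
  qed (use P Ax Ay in auto)
  have "enum_mat xs A = enum_mat xs A * (P * Q)" using Ax PQ by simp
  also have "\<dots> = P * enum_mat ys A * Q"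
    using AP Ax P Q by (simp add: assoc_mult_mat[symmetric, of _ n n _ n _ n])
  finally have "similar_mat (enum_mat xs A) (enum_mat ys A)"
    using P Q Ax Ay PQ QP unfolding similar_mat_def similar_mat_wit_def
    by (intro exI[of _ P] exI[of _ Q]) (auto simp: Let_def)
  then show ?thesis by (rule char_poly_similar)
qed

text \<open>\<open>lap_eigenvalue V E w k\<close> is $\lambda_k(w)$, counted from \<open>k = 1\<close>: the \<open>k\<close>-th entry of the
  increasing list of eigenvalues, repeated according to their multiplicity as roots of the
  characteristic polynomial. It is meaningful for \<open>1 \<le> k \<le> card V\<close>.\<close>

definition lap_eigenvalue :: "'a set \<Rightarrow> 'a set set \<Rightarrow> ('a set \<Rightarrow> real) \<Rightarrow> nat \<Rightarrow> real" where
  "lap_eigenvalue V E w k =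
     sorted_list_of_multiset
       (proots (char_poly (enum_mat (vertex_list V) (laplacian V E w)))) ! (k - 1)"

definition lap_eigenvector ::
  "'a set \<Rightarrow> 'a set set \<Rightarrow> ('a set \<Rightarrow> real) \<Rightarrow> ('a \<Rightarrow> real) \<Rightarrow> real \<Rightarrow> bool" where
  "lap_eigenvector V E w \<phi> \<mu> \<longleftrightarrow>
     (\<exists>v\<in>V. \<phi> v \<noteq> 0) \<and> (\<forall>u\<in>V. (\<Sum>v\<in>V. laplacian V E w u v * \<phi> v) = \<mu> * \<phi> u)"

definition ones :: "'a set \<Rightarrow> real" where
  "ones = (\<lambda>_. 1)"

definition normalized_weight :: "'a set set \<Rightarrow> ('a set \<Rightarrow> real) \<Rightarrow> bool" where
  "normalized_weight E w \<longleftrightarrow> (\<forall>e\<in>E. 0 \<le> w e) \<and> (\<Sum>e\<in>E. w e) = real (card E)"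

definition conformally_rigid :: "'a set \<Rightarrow> 'a set set \<Rightarrow> bool" where
  "conformally_rigid V E \<longleftrightarrow>
     simple_connected_graph V E \<and>
     (\<forall>w w'. normalized_weight E w \<longrightarrow> normalized_weight E w' \<longrightarrow>
        lap_eigenvalue V E w 2 \<le> lap_eigenvalue V E ones 2 \<and>
        lap_eigenvalue V E ones 2 \<le> lap_eigenvalue V E ones (card V) \<and>
        lap_eigenvalue V E ones (card V) \<le> lap_eigenvalue V E w' (card V))"

definition cayley_edges :: "('a, 'b) monoid_scheme \<Rightarrow> 'a set \<Rightarrow> 'a set set" where
  "cayley_edges G S = {{g, g \<otimes>\<^bsub>G\<^esub> s} | g s. g \<in> carrier G \<and> s \<in> S}"

end

theory Submission
  imports Defs "HOL-Combinatorics.List_Permutation"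
begin

text \<open>For \<open>\<phi> \<in> {\<phi>\<^sub>2, \<phi>\<^sub>n}\<close> all left translates \<open>g \<mapsto> \<phi> (h \<otimes> g)\<close> are test vectors with the same norm. Summing
  their Dirichlet energies for a weight \<open>w\<close> over \<open>h\<close> replaces \<open>w\<close> on each edge \<open>{g, g \<otimes> s}\<close> by the
  factor \<open>\<Sum>x. (\<phi> x - \<phi> (x \<otimes> s))\<^sup>2\<close>, which by assumption does not depend on \<open>s\<close>. So the average energy
  depends only on the total weight, hence is the same for every normalized \<open>w\<close> as for \<open>ones\<close>,
  where it is the eigenvalue. The Rayleigh bounds for \<open>\<lambda>\<^sub>2(w)\<close> and \<open>\<lambda>\<^sub>n(w)\<close> conclude.\<close>

section \<open>Orthogonal diagonalization of real symmetric matrices\<close>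

text \<open>Over the complex numbers the characteristic polynomial has a root, and symmetry makes
  that root real. The real and imaginary parts of a complex eigenvector then satisfy the eigenvalue
  equation separately; one of them is nonzero and can be normalized.\<close>

lemma ex_unit_eigenvector_symmetric:
  fixes A :: "real mat"
  assumes A: "A \<in> carrier_mat n n" and n: "0 < n" and sym: "transpose_mat A = A"
  shows "\<exists>e v. v \<in> carrier_vec n \<and> v \<bullet> v = 1 \<and> A *\<^sub>v v = e \<cdot>\<^sub>v v"
proof -
  define B where "B = map_mat complex_of_real A"
  have B: "B \<in> carrier_mat n n" using A by (simp add: B_def)
  obtain as where as: "char_poly B = (\<Prod>a\<leftarrow>as. [:- a, 1:])" "length as = n"
    using char_poly_factorized[OF B] by blast
  then obtain a as' where "as = a # as'" using n by (cases as) auto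
  then have "poly (char_poly B) a = 0" using as by simp
  then have "eigenvalue B a" using eigenvalue_root_char_poly[OF B] by blast
  then obtain z where z: "z \<in> carrier_vec n" "z \<noteq> 0\<^sub>v n" "B *\<^sub>v z = a \<cdot>\<^sub>v z"
    using B by (auto simp: eigenvalue_def eigenvector_def)
  have symA: "A $$ (i, j) = A $$ (j, i)" if "i < n" "j < n" for i j
    using arg_cong[OF sym, of "\<lambda>M. M $$ (j, i)"] A that by simp
  have ev: "(\<Sum>j<n. complex_of_real (A $$ (i, j)) * z $ j) = a * z $ i" if "i < n" for i
    using arg_cong[OF z(3), of "\<lambda>v. v $ i"] that A z(1)
    by (simp add: B_def scalar_prod_def atLeast0LessThan)
  \<comment> \<open>\<open>N\<close> is the squared Hermitian norm of \<open>z\<close>, and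
    \<open>a * N\<close> is the Hermitian form of the matrix at \<open>z\<close>. Both are fixed by
    conjugation and \<open>N\<close> is nonzero, so \<open>a\<close> is real.\<close>
  define N where "N = (\<Sum>i<n. cnj (z $ i) * z $ i)"
  have aN: "a * N = (\<Sum>i<n. \<Sum>j<n. cnj (z $ i) * complex_of_real (A $$ (i, j)) * z $ j)"
  proof -
    have "a * N = (\<Sum>i<n. cnj (z $ i) * (a * z $ i))"
      by (simp add: N_def sum_distrib_left mult_ac)
    also have "\<dots> = (\<Sum>i<n. cnj (z $ i) * (\<Sum>j<n. complex_of_real (A $$ (i, j)) * z $ j))"
      by (rule sum.cong) (simp_all add: ev)
    finally show ?thesis by (simp add: sum_distrib_left mult.assoc)
  qed
  have "cnj (a * N) = (\<Sum>i<n. \<Sum>j<n. cnj (z $ j) * complex_of_real (A $$ (i, j)) * z $ i)"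
    unfolding aN by (simp add: mult_ac)
  also have "\<dots> = (\<Sum>j<n. \<Sum>i<n. cnj (z $ j) * complex_of_real (A $$ (i, j)) * z $ i)"
    by (rule sum.swap)
  also have "\<dots> = a * N"
    unfolding aN by (intro sum.cong) (simp_all add: symA)
  finally have "cnj a * cnj N = a * N" by simp
  moreover have "cnj N = N" by (simp add: N_def mult.commute)
  moreover have "N \<noteq> 0"
  proof
    assume "N = 0"
    have "complex_of_real (\<Sum>i<n. (cmod (z $ i))\<^sup>2) = N"
      unfolding N_def of_real_sum by (intro sum.cong) (simp_all only: complex_norm_square mult.commute)
    then have "(\<Sum>i<n. (cmod (z $ i))\<^sup>2) = 0" using \<open>N = 0\<close> by (metis of_real_eq_0_iff)
    then have "\<forall>i<n. z $ i = 0" by (simp add: sum_nonneg_eq_0_iff)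
    then show False using z(1,2) by auto
  qed
  ultimately have "cnj a = a" by simp
  then obtain e where e: "a = complex_of_real e"
    by (metis complex_is_Real_iff cnj.simps(2) neg_equal_zero Reals_cases)
  define re im where "re = vec n (\<lambda>i. Re (z $ i))" and "im = vec n (\<lambda>i. Im (z $ i))"
  have "A *\<^sub>v re = e \<cdot>\<^sub>v re"
  proof (rule eq_vecI)
    fix i assume "i < dim_vec (e \<cdot>\<^sub>v re)"
    then have i: "i < n" by (simp add: re_def)
    then show "(A *\<^sub>v re) $ i = (e \<cdot>\<^sub>v re) $ i"
      using arg_cong[OF ev[OF i], of Re] A by (simp add: re_def scalar_prod_def atLeast0LessThan e)
  qed (use A in \<open>auto simp: re_def\<close>)
  moreover have "A *\<^sub>v im = e \<cdot>\<^sub>v im"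
  proof (rule eq_vecI)
    fix i assume "i < dim_vec (e \<cdot>\<^sub>v im)"
    then have i: "i < n" by (simp add: im_def)
    then show "(A *\<^sub>v im) $ i = (e \<cdot>\<^sub>v im) $ i"
      using arg_cong[OF ev[OF i], of Im] A by (simp add: im_def scalar_prod_def atLeast0LessThan e)
  qed (use A in \<open>auto simp: im_def\<close>)
  moreover have "re \<noteq> 0\<^sub>v n \<or> im \<noteq> 0\<^sub>v n"
  proof (rule ccontr)
    assume "\<not> ?thesis"
    then have "vec n (\<lambda>i. Re (z $ i)) $ i = 0" "vec n (\<lambda>i. Im (z $ i)) $ i = 0" if "i < n" for i
      using that by (simp_all add: re_def im_def)
    then have "z $ i = 0" if "i < n" for i using that by (simp add: complex_eq_iff)
    then show False using z(1,2) by auto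
  qed
  moreover have "re \<in> carrier_vec n" "im \<in> carrier_vec n" by (simp_all add: re_def im_def)
  ultimately obtain v where v: "v \<in> carrier_vec n" "v \<noteq> 0\<^sub>v n" "A *\<^sub>v v = e \<cdot>\<^sub>v v"
    by blast
  have vv: "0 < v \<bullet> v"
  proof -
    have "v \<bullet> v = (\<Sum>i<n. (v $ i)\<^sup>2)"
      using v(1) by (simp add: scalar_prod_def atLeast0LessThan power2_eq_square)
    moreover have "\<exists>i<n. v $ i \<noteq> 0" using v(1,2) by auto
    ultimately show ?thesis by (auto intro: sum_pos2)
  qed
  define c where "c = inverse (sqrt (v \<bullet> v))"
  have "(c \<cdot>\<^sub>v v) \<bullet> (c \<cdot>\<^sub>v v) = c * (c * (v \<bullet> v))" using v(1) by simp
  also have "\<dots> = 1" using vv by (simp add: c_def field_simps)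
  finally have "(c \<cdot>\<^sub>v v) \<bullet> (c \<cdot>\<^sub>v v) = 1" .
  moreover have "A *\<^sub>v (c \<cdot>\<^sub>v v) = e \<cdot>\<^sub>v (c \<cdot>\<^sub>v v)"
    using mult_mat_vec[OF A v(1)] v(3) by (simp add: smult_smult_assoc mult.commute)
  ultimately show ?thesis using v(1) by (intro exI[of _ e] exI[of _ "c \<cdot>\<^sub>v v"]) simp
qed

text \<open>If \<open>v\<close> differs from the first unit vector, the reflection that exchanges
  these two unit vectors has \<open>v\<close> as its first column. Like every reflection it is
  symmetric and its own inverse.\<close>

lemma ex_householder_mat:
  fixes v :: "real vec"
  assumes v: "v \<in> carrier_vec n" and unit: "v \<bullet> v = 1" and n: "0 < n"
  shows "\<exists>H \<in> carrier_mat n n. transpose_mat H = H \<and> H * H = 1\<^sub>m n \<and> col H 0 = v"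
proof -
  define w where "w = v - unit_vec n 0"
  \<comment> \<open>This is 2 divided by the squared length of \<open>w\<close>, computed below as
    \<open>2 * (1 - v $ 0)\<close>. If \<open>v $ 0 = 1\<close>, then \<open>w\<close> vanishes,
    division by zero gives \<open>c = 0\<close>, and \<open>H\<close> is the identity.\<close>
  define c where "c = 1 / (1 - v $ 0)"
  define H where "H = mat n n (\<lambda>(i, j). (if i = j then 1 else 0) - c * w $ i * w $ j)"
  have H: "H \<in> carrier_mat n n" by (simp add: H_def)
  have w: "w $ i = v $ i - (if i = 0 then 1 else 0)" if "i < n" for i
    using that v n by (simp add: w_def)
  have sv: "(\<Sum>i<n. v $ i * v $ i) = 1"
    using unit v by (simp add: scalar_prod_def atLeast0LessThan)
  have sw: "(\<Sum>i<n. w $ i * w $ i) = 2 * (1 - v $ 0)"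
  proof -
    have "(\<Sum>i<n. w $ i * w $ i) = (\<Sum>i<n. v $ i * v $ i + (if i = 0 then 1 - 2 * v $ 0 else 0))"
      by (intro sum.cong) (auto simp: w algebra_simps)
    then show ?thesis using n sv by (simp add: sum.distrib)
  qed
  have w0: "w $ i = 0" if "v $ 0 = 1" "i < n" for i
  proof -
    have "(\<Sum>i<n. w $ i * w $ i) = 0" using sw that by simp
    then show ?thesis using that by (simp add: sum_nonneg_eq_0_iff)
  qed
  have cw: "c * (c * (\<Sum>i<n. w $ i * w $ i)) = 2 * c"
  proof (cases "v $ 0 = 1")
    case False
    then have "c * (1 - v $ 0) = 1" by (simp add: c_def)
    then have "2 * c * (c * (1 - v $ 0)) = 2 * c" by simp
    then show ?thesis unfolding sw by (simp only: mult_ac)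
  qed (simp add: c_def)
  have "transpose_mat H = H" by (rule eq_matI) (auto simp: H_def)
  moreover have "H * H = 1\<^sub>m n"
  proof (rule eq_matI)
    fix i j assume "i < dim_row (1\<^sub>m n :: real mat)" "j < dim_col (1\<^sub>m n :: real mat)"
    then have ij: "i < n" "j < n" by auto
    have "(H * H) $$ (i, j) = (\<Sum>k<n. ((if i = k then 1 else 0) - c * w $ i * w $ k) *
        ((if k = j then 1 else 0) - c * w $ k * w $ j))"
      using ij by (simp add: H_def scalar_prod_def atLeast0LessThan)
    also have "\<dots> = (\<Sum>k<n. (if k = i then (if i = j then 1 else 0) - c * w $ i * w $ j else 0)
        - (if k = j then c * w $ i * w $ j else 0)
        + c * c * w $ i * w $ j * (w $ k * w $ k))"
      by (intro sum.cong) (auto simp: algebra_simps)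
    also have "\<dots> = (if i = j then 1 else 0) - 2 * c * w $ i * w $ j
        + c * (c * (\<Sum>k<n. w $ k * w $ k)) * w $ i * w $ j"
      using ij by (simp add: sum.distrib sum_subtractf sum_distrib_left sum_distrib_right mult_ac)
    finally show "(H * H) $$ (i, j) = 1\<^sub>m n $$ (i, j)" using ij by (simp add: cw)
  qed (simp_all add: H_def)
  moreover have "col H 0 = v"
  proof (rule eq_vecI)
    fix i assume "i < dim_vec v"
    then have i: "i < n" using v by simp
    show "col H 0 $ i = v $ i"
    proof (cases "v $ 0 = 1")
      case True
      then show ?thesis using i n w[OF i] w0[OF True i] by (auto simp: H_def)
    next
      case False
      then have "c * w $ 0 = - 1" using n by (simp add: w c_def field_simps)
      then have "(c * w $ 0) * w $ i = - w $ i" by simp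
      then have "c * w $ i * w $ 0 = - w $ i" by (simp only: mult_ac)
      then show ?thesis using i n w[OF i] by (auto simp: H_def)
    qed
  qed (use v in \<open>simp add: H_def\<close>)
  ultimately show ?thesis using H by blast
qed

text \<open>Deflation: a Householder matrix moves a unit eigenvector to the first basis vector,
  which splits off a block of size one. The remaining block is again symmetric and falls to the
  induction hypothesis.\<close>

lemma orthogonal_diagonalization:
  fixes A :: "real mat"
  assumes "A \<in> carrier_mat n n" and "transpose_mat A = A"
  shows "\<exists>P \<in> carrier_mat n n. \<exists>D \<in> carrier_mat n n.
    diagonal_mat D \<and> transpose_mat P * P = 1\<^sub>m n \<and> A * P = P * D"
  using assms
proof (induction n arbitrary: A)
  case 0
  then show ?case by (intro bexI[of _ A]) (auto simp: diagonal_mat_def intro!: eq_matI)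
next
  case (Suc n)
  note A = Suc.prems(1) and sym = Suc.prems(2)
  obtain e v where v: "v \<in> carrier_vec (Suc n)" "v \<bullet> v = 1" "A *\<^sub>v v = e \<cdot>\<^sub>v v"
    using ex_unit_eigenvector_symmetric[OF A _ sym] by blast
  obtain H where H: "H \<in> carrier_mat (Suc n) (Suc n)" "transpose_mat H = H"
      "H * H = 1\<^sub>m (Suc n)" "col H 0 = v"
    using ex_householder_mat[OF v(1,2)] by blast
  note assoc = assoc_mult_mat[of _ "Suc n" "Suc n" _ "Suc n" _ "Suc n"]
  \<comment> \<open>Since \<open>H\<close> is a symmetric involution with first column
    \<open>v\<close>, the first column of \<open>B\<close> is a multiple of the first unit vector.
    By symmetry of \<open>B\<close> so is its first row.\<close>
  define B where "B = H * A * H"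
  have B: "B \<in> carrier_mat (Suc n) (Suc n)" using H A by (simp add: B_def)
  have symB: "transpose_mat B = B"
    using H(1,2) A sym by (simp add: B_def assoc transpose_mult[of _ "Suc n" "Suc n" _ "Suc n"])
  have "col B 0 = (H * A) *\<^sub>v v" using A H(1,4) unfolding B_def by (subst col_mult2) auto
  also have "\<dots> = H *\<^sub>v (e \<cdot>\<^sub>v v)" using A H(1) v by simp
  also have "\<dots> = e \<cdot>\<^sub>v (H *\<^sub>v v)" using H(1) v(1) by (rule mult_mat_vec)
  also have "H *\<^sub>v v = col (H * H) 0" using H(1,4) by (subst col_mult2) auto
  finally have colB: "col B 0 = e \<cdot>\<^sub>v unit_vec (Suc n) 0" by (simp add: H(3))
  have B0: "B $$ (i, 0) = (if i = 0 then e else 0)" if "i < Suc n" for i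
    using arg_cong[OF colB, of "\<lambda>u. u $ i"] that B by auto
  have B0': "B $$ (0, i) = (if i = 0 then e else 0)" if "i < Suc n" for i
    using arg_cong[OF symB, of "\<lambda>M. M $$ (i, 0)"] that B B0[OF that] by simp
  define C where "C = mat n n (\<lambda>(i, j). B $$ (Suc i, Suc j))"
  have C: "C \<in> carrier_mat n n" by (simp add: C_def)
  have symC: "transpose_mat C = C"
  proof (rule eq_matI)
    fix i j assume "i < dim_row C" "j < dim_col C"
    then show "transpose_mat C $$ (i, j) = C $$ (i, j)"
      using arg_cong[OF symB, of "\<lambda>M. M $$ (Suc i, Suc j)"] B by (simp add: C_def)
  qed (simp_all add: C_def)
  \<comment> \<open>Block-diagonal matrices: they are multiplied and transposed blockwise, so each
    identity reduces to the lower right block.\<close>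
  let ?blk = "\<lambda>a :: real. \<lambda>M. four_block_mat (mat 1 1 (\<lambda>_. a)) (0\<^sub>m 1 n) (0\<^sub>m n 1) M"
  have B_blk: "B = ?blk e C"
    by (rule eq_matI) (use B B0 B0' in \<open>auto simp: C_def\<close>)
  obtain P D where PD: "P \<in> carrier_mat n n" "D \<in> carrier_mat n n" "diagonal_mat D"
      "transpose_mat P * P = 1\<^sub>m n" "C * P = P * D"
    using Suc.IH[OF C symC] by blast
  have blk: "?blk a M \<in> carrier_mat (Suc n) (Suc n)" if "M \<in> carrier_mat n n" for a M
    using that by (metis four_block_carrier_mat mat_carrier plus_1_eq_Suc)
  have blk_mult: "?blk a M * ?blk b N = ?blk (a * b) (M * N)"
    if "M \<in> carrier_mat n n" "N \<in> carrier_mat n n" for a b M N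
    using that
    by (subst mult_four_block_mat[of _ 1 1 _ n _ n _ _ 1 _ n])
      (auto simp: scalar_prod_def intro!: eq_matI cong_four_block_mat)
  have blk_one: "?blk 1 (1\<^sub>m n) = 1\<^sub>m (Suc n)"
    by (rule eq_matI) auto
  have blk_trans: "transpose_mat (?blk a M) = ?blk a (transpose_mat M)"
    if "M \<in> carrier_mat n n" for a M
    using that by (intro eq_matI) auto
  \<comment> \<open>\<open>?blk 1 P\<close> diagonalizes \<open>B\<close>, and \<open>H\<close>
    carries its columns back to the original coordinates.\<close>
  define Q where "Q = H * ?blk 1 P"
  have P1: "?blk 1 P \<in> carrier_mat (Suc n) (Suc n)" and D1: "?blk e D \<in> carrier_mat (Suc n) (Suc n)"
    using blk PD by auto
  have Q: "Q \<in> carrier_mat (Suc n) (Suc n)" unfolding Q_def by (rule mult_carrier_mat[OF H(1) P1])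
  have tP1: "transpose_mat (?blk 1 P) \<in> carrier_mat (Suc n) (Suc n)" using P1 by simp
  have "transpose_mat Q * Q = transpose_mat (?blk 1 P) * (H * (H * ?blk 1 P))"
    unfolding Q_def transpose_mult[OF H(1) P1] H(2)
    by (rule assoc[OF tP1 H(1) mult_carrier_mat[OF H(1) P1]])
  also have "H * (H * ?blk 1 P) = ?blk 1 P"
    using assoc[OF H(1) H(1) P1] H(3) left_mult_one_mat[OF P1] by metis
  also have "transpose_mat (?blk 1 P) * ?blk 1 P = 1\<^sub>m (Suc n)"
    using PD blk_mult[of "transpose_mat P" P 1 1] blk_trans[of P 1] blk_one by simp
  finally have "transpose_mat Q * Q = 1\<^sub>m (Suc n)" .
  moreover have "A * Q = Q * ?blk e D"
  proof -
    have "A * Q = (H * H) * (A * (H * ?blk 1 P))"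
      using A Q by (simp add: H(3) Q_def)
    also have "\<dots> = H * (B * ?blk 1 P)"
      unfolding B_def using A H(1) P1 by (simp add: assoc del: index_mat_four_block)
    also have "B * ?blk 1 P = ?blk 1 P * ?blk e D"
      unfolding B_blk using blk_mult[OF C PD(1)] blk_mult[OF PD(1,2)] PD(5) by simp
    also have "H * (?blk 1 P * ?blk e D) = Q * ?blk e D"
      unfolding Q_def using assoc[OF H(1) P1 D1] by simp
    finally show ?thesis .
  qed
  moreover have "diagonal_mat (?blk e D)"
    using PD(2,3) by (auto simp: diagonal_mat_def)
  ultimately show ?case using Q D1 by blast
qed

section \<open>Spectral decomposition and eigenvalue bounds for quadratic forms\<close>

text \<open>The first two clauses are the column and row orthogonality of the matrix with entries
  \<open>b i v\<close>. The second one, completeness, is the form in which the basis gets inserted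
  into sums over \<open>V\<close>.\<close>

definition eigenbasis :: "'a set \<Rightarrow> ('a \<Rightarrow> 'a \<Rightarrow> real) \<Rightarrow> (nat \<Rightarrow> real) \<Rightarrow> (nat \<Rightarrow> 'a \<Rightarrow> real) \<Rightarrow> bool" where
  "eigenbasis V A \<mu> b \<longleftrightarrow>
     (\<forall>i<card V. \<forall>j<card V. (\<Sum>v\<in>V. b i v * b j v) = (if i = j then 1 else 0)) \<and>
     (\<forall>u\<in>V. \<forall>v\<in>V. (\<Sum>i<card V. b i u * b i v) = (if u = v then 1 else 0)) \<and>
     (\<forall>i<card V. \<forall>u\<in>V. (\<Sum>v\<in>V. A u v * b i v) = \<mu> i * b i u)"

text \<open>The list read by \<open>lap_eigenvalue\<close>, for an arbitrary real function of two
  vertices in place of the Laplacian. Its indices start at 0, so the second eigenvalue is entry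
  1.\<close>

definition eigenvalue_list :: "'a set \<Rightarrow> ('a \<Rightarrow> 'a \<Rightarrow> real) \<Rightarrow> real list" where
  "eigenvalue_list V A = sorted_list_of_multiset (proots (char_poly (enum_mat (vertex_list V) A)))"

definition qform :: "'a set \<Rightarrow> ('a \<Rightarrow> 'a \<Rightarrow> real) \<Rightarrow> ('a \<Rightarrow> real) \<Rightarrow> real" where
  "qform V A x = (\<Sum>u\<in>V. \<Sum>v\<in>V. x u * A u v * x v)"

lemma sorted_eigenvalue_list: "sorted (eigenvalue_list V A)"
  by (simp add: eigenvalue_list_def)

text \<open>Orthogonal diagonalization along an enumeration of \<open>V\<close>: the roots of the
  characteristic polynomial are the diagonal entries of \<open>D\<close>, as many as there are
  vertices, and the columns of \<open>P\<close> are the eigenvectors. What remains is to match them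
  with the sorted list.\<close>

lemma spectral_theorem_symmetric:
  fixes A :: "'a \<Rightarrow> 'a \<Rightarrow> real"
  assumes fin: "finite V" and sym: "\<And>u v. u \<in> V \<Longrightarrow> v \<in> V \<Longrightarrow> A u v = A v u"
  shows "length (eigenvalue_list V A) = card V"
    and "\<exists>b. eigenbasis V A ((!) (eigenvalue_list V A)) b"
proof -
  define xs n where "xs = vertex_list V" and "n = card V"
  have "\<exists>xs. distinct xs \<and> set xs = V" using finite_distinct_list[OF fin] by blast
  then have xs: "distinct xs" "set xs = V" unfolding xs_def vertex_list_def by (metis (mono_tags, lifting) someI_ex)+
  have len: "length xs = n" using xs distinct_card[of xs] by (simp add: n_def)
  have xsV: "xs ! i \<in> V" if "i < n" for i using that xs len by auto
  define M where "M = enum_mat xs A"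
  have M: "M \<in> carrier_mat n n" by (simp add: M_def enum_mat_def len)
  have "transpose_mat M = M"
    by (rule eq_matI) (auto simp: M_def enum_mat_def len sym xsV)
  then obtain P D where PD: "P \<in> carrier_mat n n" "D \<in> carrier_mat n n" "diagonal_mat D"
      "transpose_mat P * P = 1\<^sub>m n" "M * P = P * D"
    using orthogonal_diagonalization[OF M] by blast
  have tP: "transpose_mat P \<in> carrier_mat n n" using PD(1) by simp
  have PtP: "P * transpose_mat P = 1\<^sub>m n" using mat_mult_left_right_inverse[OF tP PD(1,4)] .
  define es where "es = diag_mat D"
  have es: "es ! i = D $$ (i, i)" if "i < n" for i
    using PD(2) that by (auto simp: es_def diag_mat_def)
  have les: "length es = n" using PD(2) by (auto simp: es_def diag_mat_def)
  have "M = M * (P * transpose_mat P)" using M PtP by simp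
  also have "\<dots> = P * D * transpose_mat P" using M PD tP by (metis assoc_mult_mat)
  finally have "similar_mat M D"
    using M PD PtP tP unfolding similar_mat_def similar_mat_wit_def
    by (intro exI[of _ P] exI[of _ "transpose_mat P"]) (auto simp: Let_def)
  then have "char_poly M = char_poly D" by (rule char_poly_similar)
  also have "\<dots> = (\<Prod>a\<leftarrow>es. [:- a, 1:])" unfolding es_def
    using PD(2,3) by (intro char_poly_upper_triangular) (auto simp: diagonal_mat_def)
  also have "proots \<dots> = mset es"
    by (induction es) (simp_all add: proots_mult prod_list_zero_iff image_iff del: mult_pCons_left)
  finally have ev: "eigenvalue_list V A = sort es"
    by (simp add: eigenvalue_list_def M_def xs_def)
  then show "length (eigenvalue_list V A) = card V" using les by (simp add: n_def)
  have "mset (eigenvalue_list V A) = mset es" using ev by simp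
  \<comment> \<open>Sorting permutes the diagonal of \<open>D\<close>; \<open>f i\<close> is the
    column of \<open>P\<close> that belongs to entry \<open>i\<close> of the sorted list.\<close>
  then obtain f where f: "bij_betw f {..<n} {..<n}"
      "\<And>i. i < n \<Longrightarrow> eigenvalue_list V A ! i = es ! f i"
    using permutation_Ex_bij[of "eigenvalue_list V A" es] les ev by auto
  have fn: "f i < n" if "i < n" for i using f(1) that by (auto simp: bij_betw_def)
  have bij: "bij_betw ((!) xs) {..<n} V" using bij_betw_nth[OF xs(1)] len xs(2) by simp
  define idx where "idx = inv_into {..<n} ((!) xs)"
  have idx: "idx v < n" "xs ! idx v = v" if "v \<in> V" for v
    using that bij inv_into_into[of v "(!) xs" "{..<n}"] f_inv_into_f[of v "(!) xs" "{..<n}"]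
    by (auto simp: idx_def bij_betw_def)
  have idx_nth: "idx (xs ! i) = i" if "i < n" for i
    using that bij by (auto simp: idx_def bij_betw_def)
  define b where "b = (\<lambda>i v. P $$ (idx v, f i))"
  have orth: "(\<Sum>k<n. P $$ (k, i) * P $$ (k, j)) = (if i = j then 1 else 0)" if "i < n" "j < n" for i j
    using arg_cong[OF PD(4), of "\<lambda>X. X $$ (i, j)"] that PD(1)
    by (simp add: scalar_prod_def atLeast0LessThan)
  have compl: "(\<Sum>k<n. P $$ (i, k) * P $$ (j, k)) = (if i = j then 1 else 0)" if "i < n" "j < n" for i j
    using arg_cong[OF PtP, of "\<lambda>X. X $$ (i, j)"] that PD(1)
    by (simp add: scalar_prod_def atLeast0LessThan)
  have eig: "(\<Sum>k<n. A (xs ! i) (xs ! k) * P $$ (k, j)) = es ! j * P $$ (i, j)" if "i < n" "j < n" for i j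
  proof -
    have "(\<Sum>k<n. A (xs ! i) (xs ! k) * P $$ (k, j)) = (M * P) $$ (i, j)"
      using that PD(1) M by (simp add: scalar_prod_def atLeast0LessThan) (simp add: M_def enum_mat_def len)
    also have "\<dots> = (\<Sum>k<n. P $$ (i, k) * D $$ (k, j))"
      unfolding PD(5) using that PD(1,2) by (simp add: scalar_prod_def atLeast0LessThan)
    also have "\<dots> = (\<Sum>k<n. if k = j then P $$ (i, j) * D $$ (j, j) else 0)"
      using PD(2,3) that by (intro sum.cong) (auto simp: diagonal_mat_def)
    finally show ?thesis using that by (simp add: es)
  qed
  have "(\<Sum>v\<in>V. b i v * b j v) = (if i = j then 1 else 0)" if "i < n" "j < n" for i j
  proof -
    have "(\<Sum>v\<in>V. b i v * b j v) = (\<Sum>k<n. P $$ (k, f i) * P $$ (k, f j))"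
      by (subst sum.reindex_bij_betw[OF bij, symmetric]) (simp add: b_def idx_nth)
    then show ?thesis using orth[OF fn fn, OF that] that f(1) by (auto simp: bij_betw_def inj_on_def)
  qed
  moreover have "(\<Sum>i<n. b i u * b i v) = (if u = v then 1 else 0)" if "u \<in> V" "v \<in> V" for u v
  proof -
    have "(\<Sum>i<n. b i u * b i v) = (\<Sum>j<n. P $$ (idx u, j) * P $$ (idx v, j))"
      unfolding b_def by (rule sum.reindex_bij_betw[OF f(1)])
    moreover have "idx u = idx v \<longleftrightarrow> u = v" using idx(2) that by metis
    ultimately show ?thesis using compl[OF idx(1) idx(1), OF that] by simp
  qed
  moreover have "(\<Sum>v\<in>V. A u v * b i v) = eigenvalue_list V A ! i * b i u" if "i < n" "u \<in> V" for i u
  proof -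
    have "(\<Sum>v\<in>V. A u v * b i v) = (\<Sum>k<n. A (xs ! idx u) (xs ! k) * P $$ (k, f i))"
      by (subst sum.reindex_bij_betw[OF bij, symmetric]) (simp add: b_def idx_nth idx(2)[OF that(2)])
    then show ?thesis using eig[OF idx(1) fn] that f(2) by (simp add: b_def)
  qed
  ultimately show "\<exists>b. eigenbasis V A ((!) (eigenvalue_list V A)) b"
    unfolding eigenbasis_def n_def[symmetric] by blast
qed

text \<open>One interchange of sums serves two purposes: \<open>c i = 1\<close> yields the norm and
  \<open>c i = \<mu> i\<close> the quadratic form, both in eigenbasis coordinates.\<close>

lemma sum_squares_coordinates:
  fixes b :: "nat \<Rightarrow> 'a \<Rightarrow> real"
  shows "(\<Sum>u\<in>V. \<Sum>v\<in>V. x u * (\<Sum>i<n. c i * b i u * b i v) * x v) =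
    (\<Sum>i<n. c i * (\<Sum>v\<in>V. b i v * x v)\<^sup>2)"
proof -
  have "(\<Sum>u\<in>V. \<Sum>v\<in>V. x u * (\<Sum>i<n. c i * b i u * b i v) * x v) =
      (\<Sum>u\<in>V. \<Sum>v\<in>V. \<Sum>i<n. c i * (b i u * x u) * (b i v * x v))"
    by (simp add: sum_distrib_left sum_distrib_right mult_ac)
  also have "\<dots> = (\<Sum>u\<in>V. \<Sum>i<n. \<Sum>v\<in>V. c i * (b i u * x u) * (b i v * x v))"
    by (intro sum.cong refl sum.swap)
  also have "\<dots> = (\<Sum>i<n. \<Sum>u\<in>V. \<Sum>v\<in>V. c i * (b i u * x u) * (b i v * x v))"
    by (rule sum.swap)
  also have "\<dots> = (\<Sum>i<n. c i * (\<Sum>v\<in>V. b i v * x v)\<^sup>2)"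
    by (simp add: power2_eq_square sum_product sum_distrib_left mult_ac)
  finally show ?thesis .
qed

lemma eigenbasis_parseval:
  assumes "finite V" "eigenbasis V A \<mu> b"
  shows "(\<Sum>v\<in>V. (x v)\<^sup>2) = (\<Sum>i<card V. (\<Sum>v\<in>V. b i v * x v)\<^sup>2)"
proof -
  have "(\<Sum>v\<in>V. (x v)\<^sup>2) = (\<Sum>u\<in>V. \<Sum>v\<in>V. if v = u then (x u)\<^sup>2 else 0)"
    using assms(1) by simp
  \<comment> \<open>Completeness replaces the Kronecker delta; the factor 1 is the constant
    coefficient that fits \<open>sum_squares_coordinates\<close>.\<close>
  also have "\<dots> = (\<Sum>u\<in>V. \<Sum>v\<in>V. x u * (\<Sum>i<card V. 1 * b i u * b i v) * x v)"
    using assms(2) by (intro sum.cong) (auto simp: eigenbasis_def power2_eq_square)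
  finally show ?thesis by (simp only: sum_squares_coordinates) simp
qed

text \<open>Inserting completeness behind \<open>A\<close> and applying the eigenvalue equation
  gives the spectral decomposition of \<open>A\<close>, which makes the form diagonal.\<close>

lemma eigenbasis_qform:
  assumes "finite V" "eigenbasis V A \<mu> b"
  shows "qform V A x = (\<Sum>i<card V. \<mu> i * (\<Sum>v\<in>V. b i v * x v)\<^sup>2)"
proof -
  have "A u v = (\<Sum>i<card V. \<mu> i * b i u * b i v)" if "u \<in> V" "v \<in> V" for u v
  proof -
    have "A u v = (\<Sum>w\<in>V. A u w * (if w = v then 1 else 0))"
      using assms(1) that by (simp add: if_distrib[where f = "(*) _"] cong: if_cong)
    also have "\<dots> = (\<Sum>w\<in>V. A u w * (\<Sum>i<card V. b i w * b i v))"
      using assms(2) that by (intro sum.cong) (simp_all add: eigenbasis_def)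
    also have "\<dots> = (\<Sum>w\<in>V. \<Sum>i<card V. A u w * b i w * b i v)"
      by (simp add: sum_distrib_left mult_ac)
    also have "\<dots> = (\<Sum>i<card V. (\<Sum>w\<in>V. A u w * b i w) * b i v)"
      by (subst sum.swap) (simp add: sum_distrib_right)
    also have "\<dots> = (\<Sum>i<card V. \<mu> i * b i u * b i v)"
      using assms(2) that by (intro sum.cong) (simp_all add: eigenbasis_def)
    finally show ?thesis .
  qed
  then have "qform V A x = (\<Sum>u\<in>V. \<Sum>v\<in>V. x u * (\<Sum>i<card V. \<mu> i * b i u * b i v) * x v)"
    unfolding qform_def by (intro sum.cong) simp_all
  then show ?thesis by (simp only: sum_squares_coordinates)
qed

lemma qform_eigenvector:
  assumes "\<And>u. u \<in> V \<Longrightarrow> (\<Sum>v\<in>V. A u v * x v) = \<mu> * x u"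
  shows "qform V A x = \<mu> * (\<Sum>v\<in>V. (x v)\<^sup>2)"
proof -
  have "qform V A x = (\<Sum>u\<in>V. x u * (\<Sum>v\<in>V. A u v * x v))"
    by (simp add: qform_def sum_distrib_left mult.assoc)
  also have "\<dots> = (\<Sum>u\<in>V. \<mu> * (x u)\<^sup>2)"
    using assms by (intro sum.cong) (simp_all add: power2_eq_square)
  finally show ?thesis by (simp add: sum_distrib_left)
qed

text \<open>In eigenbasis coordinates both sides are combinations of the same squares, and no
  eigenvalue exceeds the last entry of the sorted list.\<close>

lemma qform_le_largest_eigenvalue:
  assumes fin: "finite V" and sym: "\<And>u v. u \<in> V \<Longrightarrow> v \<in> V \<Longrightarrow> A u v = A v u"
  shows "qform V A x \<le> eigenvalue_list V A ! (card V - 1) * (\<Sum>v\<in>V. (x v)\<^sup>2)"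
proof -
  obtain b where b: "eigenbasis V A ((!) (eigenvalue_list V A)) b"
    using spectral_theorem_symmetric(2)[of V A] assms by blast
  have "eigenvalue_list V A ! i \<le> eigenvalue_list V A ! (card V - 1)" if "i < card V" for i
    using that sorted_nth_mono[OF sorted_eigenvalue_list, of i "card V - 1" V A]
      spectral_theorem_symmetric(1)[of V A] assms by simp
  then show ?thesis
    unfolding eigenbasis_qform[OF fin b] eigenbasis_parseval[OF fin b] sum_distrib_left
    by (intro sum_mono mult_right_mono) auto
qed

text \<open>Test the form on a combination of \<open>x\<close> and the constant vector that is orthogonal to the first
  eigenvector; there all eigenvalues that contribute are at least the second one.\<close>

lemma second_eigenvalue_le_qform:
  assumes fin: "finite V" and sym: "\<And>u v. u \<in> V \<Longrightarrow> v \<in> V \<Longrightarrow> A u v = A v u"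
    and card: "2 \<le> card V" and rows: "\<And>u. u \<in> V \<Longrightarrow> (\<Sum>v\<in>V. A u v) = 0"
    and orth: "(\<Sum>v\<in>V. x v) = 0" and nonneg: "0 \<le> qform V A x"
  shows "eigenvalue_list V A ! 1 * (\<Sum>v\<in>V. (x v)\<^sup>2) \<le> qform V A x"
proof -
  define \<mu> where "\<mu> = (!) (eigenvalue_list V A)"
  obtain b where b: "eigenbasis V A \<mu> b"
    using spectral_theorem_symmetric(2)[of V A] assms unfolding \<mu>_def by blast
  have mono: "\<mu> 1 \<le> \<mu> i" if "0 < i" "i < card V" for i
    using that sorted_nth_mono[OF sorted_eigenvalue_list, of 1 i V A]
      spectral_theorem_symmetric(1)[of V A] assms by (simp add: \<mu>_def)
  define N where "N = (\<Sum>v\<in>V. (x v)\<^sup>2)"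
  have N: "0 \<le> N" by (simp add: N_def sum_nonneg)
  define \<alpha> \<beta> where "\<alpha> = (\<Sum>v\<in>V. b 0 v)" and "\<beta> = (\<Sum>v\<in>V. b 0 v * x v)"
  \<comment> \<open>A nontrivial combination \<open>p + q * x\<close> orthogonal to
    \<open>b 0\<close>; if \<alpha> and \<beta> both vanish, \<open>x\<close> itself will do. This
    works for whatever vector \<open>b 0\<close> is, constant or not.\<close>
  obtain p q where pq: "p * \<alpha> + q * \<beta> = 0" "p \<noteq> 0 \<or> q \<noteq> 0"
  proof (cases "\<alpha> = 0 \<and> \<beta> = 0")
    case True
    then show ?thesis using that[of 0 1] by simp
  next
    case False
    then show ?thesis using that[of "\<beta>" "- \<alpha>"] by auto
  qed
  define y where "y = (\<lambda>v. p + q * x v)"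
  have y0: "(\<Sum>v\<in>V. b 0 v * y v) = 0"
    using pq(1) by (simp add: y_def \<alpha>_def \<beta>_def algebra_simps sum.distrib sum_distrib_left)
  have rowsA: "(\<Sum>u\<in>V. A u v) = 0" if "v \<in> V" for v
    using rows[OF that] sym that by (metis (no_types, lifting) sum.cong)
  \<comment> \<open>Row and column sums of \<open>A\<close> vanish, so the constant part of
    \<open>y\<close> contributes neither its own term nor a cross term.\<close>
  have "qform V A y = (\<Sum>u\<in>V. \<Sum>v\<in>V. p * p * A u v + p * q * (x u * A u v)
      + p * q * (A u v * x v) + q * q * (x u * A u v * x v))"
    unfolding qform_def by (intro sum.cong) (simp_all add: y_def algebra_simps)
  also have "\<dots> = p * p * (\<Sum>u\<in>V. \<Sum>v\<in>V. A u v) + p * q * (\<Sum>u\<in>V. x u * (\<Sum>v\<in>V. A u v))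
      + p * q * (\<Sum>u\<in>V. \<Sum>v\<in>V. A u v * x v) + q * q * qform V A x"
    by (simp add: qform_def sum.distrib sum_distrib_left)
  also have "(\<Sum>u\<in>V. \<Sum>v\<in>V. A u v * x v) = (\<Sum>v\<in>V. (\<Sum>u\<in>V. A u v) * x v)"
    by (subst sum.swap) (simp add: sum_distrib_right)
  finally have Qy: "qform V A y = q\<^sup>2 * qform V A x"
    by (simp add: rows rowsA power2_eq_square)
  have "(\<Sum>v\<in>V. (y v)\<^sup>2) = (\<Sum>v\<in>V. p\<^sup>2 + 2 * p * q * x v + q\<^sup>2 * (x v)\<^sup>2)"
    by (intro sum.cong) (simp_all add: y_def power2_eq_square algebra_simps)
  also have "\<dots> = p\<^sup>2 * card V + 2 * p * q * (\<Sum>v\<in>V. x v) + q\<^sup>2 * N"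
    by (simp add: sum.distrib sum_distrib_left N_def)
  finally have Ny: "(\<Sum>v\<in>V. (y v)\<^sup>2) = p\<^sup>2 * card V + q\<^sup>2 * N" using orth by simp
  have "\<mu> 1 * (\<Sum>v\<in>V. (y v)\<^sup>2) \<le> qform V A y"
    unfolding eigenbasis_qform[OF fin b] eigenbasis_parseval[OF fin b] sum_distrib_left
  proof (rule sum_mono)
    fix i assume "i \<in> {..<card V}"
    then show "\<mu> 1 * (\<Sum>v\<in>V. b i v * y v)\<^sup>2 \<le> \<mu> i * (\<Sum>v\<in>V. b i v * y v)\<^sup>2"
      using mono[of i] y0 by (cases "i = 0") (auto intro: mult_right_mono)
  qed
  then have ineq: "\<mu> 1 * (p\<^sup>2 * card V) + q\<^sup>2 * (\<mu> 1 * N) \<le> q\<^sup>2 * qform V A x"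
    unfolding Qy Ny by (simp add: algebra_simps)
  have "\<mu> 1 * N \<le> qform V A x"
  proof (cases "\<mu> 1 \<le> 0")
    case True
    then have "\<mu> 1 * N \<le> 0" using N by (simp add: mult_nonpos_nonneg)
    then show ?thesis using nonneg by simp
  next
    case False
    have "0 \<le> \<mu> 1 * (p\<^sup>2 * card V)" using False by simp
    then have le: "q\<^sup>2 * (\<mu> 1 * N) \<le> q\<^sup>2 * qform V A x" using ineq by simp
    have "q \<noteq> 0"
    proof
      assume "q = 0"
      then have "\<mu> 1 * (p\<^sup>2 * card V) \<le> 0" using ineq by simp
      moreover have "0 < \<mu> 1 * (p\<^sup>2 * card V)" using False pq(2) \<open>q = 0\<close> card by simp
      ultimately show False by simp
    qed
    then show ?thesis using le by simp
  qed
  then show ?thesis by (simp add: N_def \<mu>_def)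
qed

section \<open>Dirichlet energy of the weighted Laplacian, and connectivity\<close>

lemma lap_eigenvalue_eq: "lap_eigenvalue V E w k = eigenvalue_list V (laplacian V E w) ! (k - 1)"
  by (simp add: lap_eigenvalue_def eigenvalue_list_def)

lemma laplacian_sym: "laplacian V E w u v = laplacian V E w v u"
  by (simp add: laplacian_def insert_commute)

text \<open>Degree matrix minus adjacency matrix. The subtracted term vanishes on the diagonal,
  because a singleton is not an edge.\<close>

lemma laplacian_eq:
  assumes "finite V" "\<forall>e\<in>E. card e = 2" "u \<in> V" "v \<in> V"
  shows "laplacian V E w u v =
    (if u = v then (\<Sum>x\<in>V. if {u, x} \<in> E then w {u, x} else 0) else 0)
      - (if {u, v} \<in> E then w {u, v} else 0)"
proof -
  have "{u, u} \<notin> E" using assms(2) by force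
  then show ?thesis using assms(1) by (auto simp: laplacian_def sum.If_cases Int_def)
qed

lemma laplacian_row_sum:
  assumes "finite V" "\<forall>e\<in>E. card e = 2" "u \<in> V"
  shows "(\<Sum>v\<in>V. laplacian V E w u v) = 0"
  using assms by (simp add: laplacian_eq sum_subtractf)

text \<open>The Dirichlet energy. Summing over ordered pairs avoids a choice of orientation, and the
  division by 2 compensates for meeting every edge twice.\<close>

lemma qform_laplacian:
  assumes "finite V" "\<forall>e\<in>E. card e = 2"
  shows "qform V (laplacian V E w) x =
    (\<Sum>u\<in>V. \<Sum>v\<in>V. if {u, v} \<in> E then w {u, v} * (x u - x v)\<^sup>2 else 0) / 2"
proof -
  define a where "a = (\<lambda>u v. if {u, v} \<in> E then w {u, v} else 0)"
  have sym: "a u v = a v u" for u v by (simp add: a_def insert_commute)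
  have lap: "laplacian V E w u v = (if u = v then (\<Sum>z\<in>V. a u z) else 0) - a u v"
    if "u \<in> V" "v \<in> V" for u v
    unfolding a_def by (rule laplacian_eq[OF assms that])
  have "qform V (laplacian V E w) x =
      (\<Sum>u\<in>V. \<Sum>v\<in>V. (if v = u then (\<Sum>z\<in>V. a u z) * (x u)\<^sup>2 else 0) - a u v * x u * x v)"
    unfolding qform_def by (intro sum.cong) (simp_all add: lap power2_eq_square left_diff_distrib right_diff_distrib mult_ac)
  also have "\<dots> = (\<Sum>u\<in>V. \<Sum>v\<in>V. a u v * (x u)\<^sup>2) - (\<Sum>u\<in>V. \<Sum>v\<in>V. a u v * x u * x v)"
    using assms(1) by (simp add: sum_subtractf sum_distrib_right)
  finally have 1: "qform V (laplacian V E w) x =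
      (\<Sum>u\<in>V. \<Sum>v\<in>V. a u v * (x u)\<^sup>2) - (\<Sum>u\<in>V. \<Sum>v\<in>V. a u v * x u * x v)" .
  have 2: "(\<Sum>u\<in>V. \<Sum>v\<in>V. a u v * (x v)\<^sup>2) = (\<Sum>u\<in>V. \<Sum>v\<in>V. a u v * (x u)\<^sup>2)"
    by (subst sum.swap) (simp add: sym)
  have "(\<Sum>u\<in>V. \<Sum>v\<in>V. if {u, v} \<in> E then w {u, v} * (x u - x v)\<^sup>2 else 0) =
      (\<Sum>u\<in>V. \<Sum>v\<in>V. a u v * (x u)\<^sup>2 + a u v * (x v)\<^sup>2 - 2 * (a u v * x u * x v))"
    by (intro sum.cong) (auto simp: a_def power2_eq_square algebra_simps)
  also have "\<dots> = 2 * ((\<Sum>u\<in>V. \<Sum>v\<in>V. a u v * (x u)\<^sup>2) - (\<Sum>u\<in>V. \<Sum>v\<in>V. a u v * x u * x v))"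
    by (simp add: sum.distrib sum_subtractf sum_distrib_left 2)
  finally show ?thesis using 1 by simp
qed

lemma qform_laplacian_nonneg:
  assumes "finite V" "\<forall>e\<in>E. card e = 2" "\<forall>e\<in>E. 0 \<le> w e"
  shows "0 \<le> qform V (laplacian V E w) x"
  unfolding qform_laplacian[OF assms(1,2)] using assms(3) by (auto intro!: sum_nonneg)

text \<open>The pairs are grouped by the edge they span; each edge has two distinct ends and hence
  exactly two orderings.\<close>

lemma sum_ordered_edges:
  fixes w :: "'a set \<Rightarrow> real"
  assumes fin: "finite V" and E: "\<forall>e\<in>E. e \<subseteq> V \<and> card e = 2"
  shows "(\<Sum>u\<in>V. \<Sum>v\<in>V. if {u, v} \<in> E then w {u, v} else 0) = 2 * (\<Sum>e\<in>E. w e)"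
proof -
  define g S where "g = (\<lambda>p :: 'a \<times> 'a. {fst p, snd p})" and "S = {p \<in> V \<times> V. g p \<in> E}"
  have finE: "finite E" using E fin by (auto intro: finite_subset[of E "Pow V"])
  have finS: "finite S" using fin by (simp add: S_def)
  have "(\<Sum>u\<in>V. \<Sum>v\<in>V. if {u, v} \<in> E then w {u, v} else 0) =
      (\<Sum>p\<in>V \<times> V. if g p \<in> E then w (g p) else 0)"
    by (simp add: sum.cartesian_product case_prod_beta g_def cong: if_cong)
  also have "\<dots> = (\<Sum>p\<in>S. w (g p))"
    using fin by (simp add: sum.If_cases S_def Int_def)
  also have "\<dots> = (\<Sum>e\<in>E. \<Sum>p | p \<in> S \<and> g p = e. w (g p))"
    by (rule sum.group[OF finS finE, symmetric]) (auto simp: S_def)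
  also have "\<dots> = (\<Sum>e\<in>E. real (card {p \<in> S. g p = e}) * w e)"
    by simp
  also have "\<dots> = (\<Sum>e\<in>E. 2 * w e)"
  proof (rule sum.cong[OF refl])
    fix e assume e: "e \<in> E"
    then obtain a b where ab: "e = {a, b}" "a \<noteq> b" using E by (auto simp: card_2_iff)
    have g: "g p = e \<longleftrightarrow> p = (a, b) \<or> p = (b, a)" for p
      by (cases p) (simp add: g_def ab(1) doubleton_eq_iff)
    have "a \<in> V" "b \<in> V" using E e ab(1) by blast+
    then have "(a, b) \<in> S" "(b, a) \<in> S" using e g[of "(a, b)"] g[of "(b, a)"] by (simp_all add: S_def)
    then have "{p \<in> S. g p = e} = {(a, b), (b, a)}" using g by blast
    then show "real (card {p \<in> S. g p = e}) * w e = 2 * w e"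
      using ab(2) by simp
  qed
  finally show ?thesis by (simp add: sum_distrib_left)
qed

text \<open>A vanishing sum of squares forces equal values across each edge, and connectivity
  carries the equality along paths.\<close>

lemma qform_laplacian_ones_eq_0_imp_constant:
  assumes G: "simple_connected_graph V E" and zero: "qform V (laplacian V E ones) x = 0"
    and "u \<in> V" "v \<in> V"
  shows "x u = x v"
proof -
  have fin: "finite V" and E: "\<forall>e\<in>E. e \<subseteq> V" "\<forall>e\<in>E. card e = 2"
    and conn: "(u, v) \<in> {(x, y). {x, y} \<in> E}\<^sup>*"
    using G assms(3,4) by (auto simp: simple_connected_graph_def)
  have "(\<Sum>u\<in>V. \<Sum>v\<in>V. if {u, v} \<in> E then (x u - x v)\<^sup>2 else 0) = 0"
    using zero fin E(2) by (simp add: qform_laplacian ones_def cong: if_cong)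
  then have all0: "\<forall>u\<in>V. \<forall>v\<in>V. (if {u, v} \<in> E then (x u - x v)\<^sup>2 else 0) = 0"
    using fin by (simp add: sum_nonneg_eq_0_iff sum_nonneg cong: if_cong)
  have edge: "x u = x v" if "{u, v} \<in> E" for u v
  proof -
    have "u \<in> V" "v \<in> V" using E(1) that by blast+
    then have "(x u - x v)\<^sup>2 = 0" using all0 that by metis
    then show ?thesis by simp
  qed
  from conn show ?thesis by (induction rule: rtrancl_induct) (auto dest: edge)
qed

text \<open>If the first two eigenvalues were both 0, their eigenvectors would have zero energy and
  so be constant; but two nonzero constant vectors are not orthogonal. Positivity is what later
  forces \<open>\<phi>\<^sub>2\<close> to have sum zero.\<close>

lemma lap_eigenvalue_2_pos:
  assumes G: "simple_connected_graph V E" and card: "2 \<le> card V"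
  shows "0 < lap_eigenvalue V E ones 2"
proof -
  have fin: "finite V" and E: "\<forall>e\<in>E. card e = 2"
    using G by (auto simp: simple_connected_graph_def)
  define \<mu> where "\<mu> = (!) (eigenvalue_list V (laplacian V E ones))"
  obtain b where b: "eigenbasis V (laplacian V E ones) \<mu> b"
    using spectral_theorem_symmetric(2)[of V "laplacian V E ones", OF fin laplacian_sym] unfolding \<mu>_def by blast
  have norm: "(\<Sum>v\<in>V. (b i v)\<^sup>2) = 1" if "i < card V" for i
    using b that by (auto simp: eigenbasis_def power2_eq_square)
  have Q: "qform V (laplacian V E ones) (b i) = \<mu> i" if "i < card V" for i
    using b that by (subst qform_eigenvector[where \<mu> = "\<mu> i"]) (auto simp: eigenbasis_def norm)
  have "0 \<le> \<mu> i" if "i < card V" for i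
    using qform_laplacian_nonneg[OF fin E, of ones "b i"] Q[OF that] by (simp add: ones_def)
  moreover have "\<mu> 0 \<le> \<mu> 1"
    using card sorted_nth_mono[OF sorted_eigenvalue_list, of 0 1 V "laplacian V E ones"]
      spectral_theorem_symmetric(1)[of V "laplacian V E ones", OF fin laplacian_sym] by (simp add: \<mu>_def)
  \<comment> \<open>As both values are nonnegative and \<open>\<mu> 0 \<le> \<mu> 1\<close>, it
    suffices that one of them is nonzero.\<close>
  moreover have "\<mu> 1 \<noteq> 0 \<or> \<mu> 0 \<noteq> 0"
  proof (rule ccontr)
    assume "\<not> ?thesis"
    then have Q0: "qform V (laplacian V E ones) (b 0) = 0" "qform V (laplacian V E ones) (b 1) = 0"
      using Q[of 0] Q[of 1] card by auto
    obtain z where z: "z \<in> V" using card by fastforce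
    have const: "b 0 v = b 0 z" "b 1 v = b 1 z" if "v \<in> V" for v
      using qform_laplacian_ones_eq_0_imp_constant[OF G _ that z] Q0 by blast+
    have "(\<Sum>v\<in>V. b 0 v * b 1 v) = 0" using b card by (auto simp: eigenbasis_def)
    then have "b 0 z * b 1 z = 0" using const card by auto
    moreover have "card V * (b 0 z)\<^sup>2 = 1" "card V * (b 1 z)\<^sup>2 = 1"
      using norm[of 0] norm[of 1] card const by auto
    ultimately show False by auto
  qed
  ultimately have "0 < \<mu> 1" using card by (smt (verit, best) One_nat_def Suc_1 Suc_le_lessD lessI less_trans zero_less_one)
  then show ?thesis by (simp add: lap_eigenvalue_eq \<mu>_def)
qed

section \<open>Cayley graphs and averages over left translates\<close>

context group
begin

lemma cayley_edges_subset_and_card: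
  assumes "S \<subseteq> carrier G" "\<one> \<notin> S" "e \<in> cayley_edges G S"
  shows "e \<subseteq> carrier G \<and> card e = 2"
proof -
  obtain g s where e: "e = {g, g \<otimes> s}" "g \<in> carrier G" "s \<in> S"
    using assms(3) by (auto simp: cayley_edges_def)
  then have "g \<noteq> g \<otimes> s" using assms(1,2) by (metis l_cancel_one' subsetD)
  then show ?thesis using e assms(1) by auto
qed

text \<open>A word in the generators is a walk in the graph; the word for
  \<open>inv u \<otimes> v\<close> leads from \<open>u\<close> to \<open>v\<close>.\<close>

lemma simple_connected_cayley_graph:
  assumes "finite (carrier G)" "S \<subseteq> carrier G" "generate G S = carrier G"
    and inv_closed: "\<And>s. s \<in> S \<Longrightarrow> inv s \<in> S" and "\<one> \<notin> S"
  shows "simple_connected_graph (carrier G) (cayley_edges G S)"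
proof -
  define R where "R = {(x, y). {x, y} \<in> cayley_edges G S}"
  have step: "(g, g \<otimes> s) \<in> R" if "g \<in> carrier G" "s \<in> S" for g s
    using that by (auto simp: R_def cayley_edges_def)
  \<comment> \<open>All starting points are included, so that a product is handled by walking
    \<open>h1\<close> from \<open>g\<close> and then \<open>h2\<close> from
    \<open>g \<otimes> h1\<close>.\<close>
  have walk: "\<forall>g\<in>carrier G. (g, g \<otimes> h) \<in> R\<^sup>*" if "h \<in> generate G S" for h
    using that
  proof (induction rule: generate.induct)
    case (eng h1 h2)
    then have "h1 \<in> carrier G" "h2 \<in> carrier G" using assms(3) by auto
    then show ?case using eng.IH by (metis m_assoc m_closed rtrancl_trans)
  qed (use step inv_closed in auto)
  have "(u, v) \<in> R\<^sup>*" if "u \<in> carrier G" "v \<in> carrier G" for u v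
  proof -
    have "u \<otimes> (inv u \<otimes> v) = v" using that by (simp add: m_assoc[symmetric])
    then show ?thesis using that walk[of "inv u \<otimes> v"] assms(3) by auto
  qed
  then show ?thesis
    using assms cayley_edges_subset_and_card[OF assms(2,5)]
    by (auto simp: simple_connected_graph_def R_def)
qed

lemma bij_betw_left_translation:
  assumes "h \<in> carrier G"
  shows "bij_betw ((\<otimes>) h) (carrier G) (carrier G)"
  by (rule bij_betwI[where g = "(\<otimes>) (inv h)"]) (use assms in \<open>auto simp: m_assoc[symmetric]\<close>)

lemma bij_betw_right_translation:
  assumes "h \<in> carrier G"
  shows "bij_betw (\<lambda>g. g \<otimes> h) (carrier G) (carrier G)"
  by (rule bij_betwI[where g = "\<lambda>g. g \<otimes> inv h"]) (use assms in \<open>auto simp: m_assoc\<close>)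

lemma sum_left_translation:
  assumes "h \<in> carrier G"
  shows "(\<Sum>g\<in>carrier G. f (h \<otimes> g)) = (\<Sum>g\<in>carrier G. f g)"
  using bij_betw_left_translation[OF assms] by (rule sum.reindex_bij_betw)

lemma sum_right_translation:
  assumes "h \<in> carrier G"
  shows "(\<Sum>g\<in>carrier G. f (g \<otimes> h)) = (\<Sum>g\<in>carrier G. f g)"
  using bij_betw_right_translation[OF assms] by (rule sum.reindex_bij_betw)

text \<open>Edges arise by multiplication with a generator on the right, so left translations
  commute with this and are automorphisms. The converse direction translates by
  \<open>inv h\<close>.\<close>

lemma cayley_edges_translate:
  assumes "S \<subseteq> carrier G" "h \<in> carrier G" "u \<in> carrier G" "v \<in> carrier G"
  shows "{h \<otimes> u, h \<otimes> v} \<in> cayley_edges G S \<longleftrightarrow> {u, v} \<in> cayley_edges G S"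
proof -
  have *: "{h \<otimes> u, h \<otimes> v} \<in> cayley_edges G S"
    if "{u, v} \<in> cayley_edges G S" "h \<in> carrier G" for h u v
  proof -
    obtain g s where gs: "{u, v} = {g, g \<otimes> s}" "g \<in> carrier G" "s \<in> S"
      using \<open>{u, v} \<in> cayley_edges G S\<close> by (auto simp: cayley_edges_def)
    have "{h \<otimes> u, h \<otimes> v} = (\<otimes>) h ` {u, v}" by simp
    also have "\<dots> = {h \<otimes> g, (h \<otimes> g) \<otimes> s}"
      unfolding gs(1) using gs(2,3) that(2) assms(1) by (auto simp: m_assoc)
    finally show ?thesis using gs(2,3) that(2) by (auto simp: cayley_edges_def)
  qed
  show ?thesis
    using *[of u v h] *[of "h \<otimes> u" "h \<otimes> v" "inv h"] assms(2-4) by (auto simp: m_assoc[symmetric])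
qed

lemma qform_cayley_translate:
  assumes "finite (carrier G)" "S \<subseteq> carrier G" "\<one> \<notin> S" "h \<in> carrier G"
  shows "qform (carrier G) (laplacian (carrier G) (cayley_edges G S) ones) (\<lambda>g. \<phi> (h \<otimes> g)) =
    qform (carrier G) (laplacian (carrier G) (cayley_edges G S) ones) \<phi>"
proof -
  let ?E = "cayley_edges G S"
  have E: "\<forall>e\<in>?E. card e = 2" using cayley_edges_subset_and_card[OF assms(2,3)] by blast
  define F where "F = (\<lambda>u v. if {u, v} \<in> ?E then (\<phi> u - \<phi> v)\<^sup>2 else 0)"
  have "(\<Sum>u\<in>carrier G. \<Sum>v\<in>carrier G. if {u, v} \<in> ?E then (\<phi> (h \<otimes> u) - \<phi> (h \<otimes> v))\<^sup>2 else 0) =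
      (\<Sum>u\<in>carrier G. \<Sum>v\<in>carrier G. F (h \<otimes> u) (h \<otimes> v))"
    using assms(2,4) by (intro sum.cong) (simp_all add: F_def cayley_edges_translate)
  also have "\<dots> = (\<Sum>u\<in>carrier G. \<Sum>v\<in>carrier G. F u v)"
    using assms(4) by (simp add: sum_left_translation[of h "\<lambda>v. F _ v"]
        sum_left_translation[of h "\<lambda>u. \<Sum>v\<in>carrier G. F u v"])
  finally show ?thesis
    using assms(1) E by (simp add: qform_laplacian ones_def F_def cong: if_cong)
qed

text \<open>Exchanging sums leaves, for each edge, the total over \<open>h\<close> of a squared
  difference. The substitution \<open>x = h \<otimes> g\<close> makes it independent of
  \<open>g\<close>, and \<open>corr\<close> makes it independent of \<open>s\<close>, so only the
  total weight matters.\<close>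

lemma sum_qform_translates:
  assumes fin: "finite (carrier G)" and S: "S \<subseteq> carrier G" "\<one> \<notin> S"
    and corr: "\<And>s t. s \<in> S \<Longrightarrow> t \<in> S \<Longrightarrow>
      (\<Sum>g\<in>carrier G. \<phi> g * \<phi> (g \<otimes> s)) = (\<Sum>g\<in>carrier G. \<phi> g * \<phi> (g \<otimes> t))"
  shows "\<exists>c. \<forall>w. normalized_weight (cayley_edges G S) w \<longrightarrow>
    (\<Sum>h\<in>carrier G. qform (carrier G) (laplacian (carrier G) (cayley_edges G S) w) (\<lambda>g. \<phi> (h \<otimes> g))) = c"
proof -
  let ?V = "carrier G" and ?E = "cayley_edges G S"
  have E: "\<forall>e\<in>?E. e \<subseteq> ?V \<and> card e = 2" using cayley_edges_subset_and_card[OF S] by blast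
  then have E2: "\<forall>e\<in>?E. card e = 2" by blast
  \<comment> \<open>The common value of the correlations. If \<open>S\<close> is empty it is an
    arbitrary number, but then there are no edges on which it would be used.\<close>
  define k where "k = (\<Sum>g\<in>?V. \<phi> g * \<phi> (g \<otimes> (SOME s. s \<in> S)))"
  have k: "(\<Sum>g\<in>?V. \<phi> g * \<phi> (g \<otimes> s)) = k" if "s \<in> S" for s
    unfolding k_def by (rule corr[OF that someI[of "\<lambda>s. s \<in> S", OF that]])
  define c where "c = 2 * (\<Sum>g\<in>?V. (\<phi> g)\<^sup>2) - 2 * k"
  have gen: "(\<Sum>h\<in>?V. (\<phi> (h \<otimes> g) - \<phi> (h \<otimes> (g \<otimes> s)))\<^sup>2) = c" if "g \<in> ?V" "s \<in> S" for g s
  proof -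
    have s: "s \<in> ?V" using that(2) S by auto
    have "(\<Sum>h\<in>?V. (\<phi> (h \<otimes> g) - \<phi> (h \<otimes> (g \<otimes> s)))\<^sup>2) = (\<Sum>h\<in>?V. (\<phi> (h \<otimes> g) - \<phi> ((h \<otimes> g) \<otimes> s))\<^sup>2)"
      using that(1) s by (intro sum.cong) (simp_all add: m_assoc)
    also have "\<dots> = (\<Sum>x\<in>?V. (\<phi> x - \<phi> (x \<otimes> s))\<^sup>2)"
      using sum_right_translation[OF that(1), of "\<lambda>x. (\<phi> x - \<phi> (x \<otimes> s))\<^sup>2"] .
    also have "\<dots> = (\<Sum>x\<in>?V. (\<phi> x)\<^sup>2 + (\<phi> (x \<otimes> s))\<^sup>2 - 2 * (\<phi> x * \<phi> (x \<otimes> s)))"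
      by (intro sum.cong) (simp_all add: power2_eq_square algebra_simps)
    also have "\<dots> = c"
      using sum_right_translation[OF s, of "\<lambda>x. (\<phi> x)\<^sup>2"] k[OF that(2)]
      by (simp add: c_def sum.distrib sum_subtractf sum_distrib_left[symmetric])
    finally show ?thesis .
  qed
  have edge: "(\<Sum>h\<in>?V. (\<phi> (h \<otimes> u) - \<phi> (h \<otimes> v))\<^sup>2) = c" if uv: "{u, v} \<in> ?E" for u v
  proof -
    obtain g s where gs: "{u, v} = {g, g \<otimes> s}" "g \<in> ?V" "s \<in> S"
      using uv by (auto simp: cayley_edges_def)
    \<comment> \<open>The edge is unordered, so either end may be the one multiplied by
      \<open>s\<close>; the squared difference is symmetric.\<close>
    from gs(1) consider "u = g" "v = g \<otimes> s" | "v = g" "u = g \<otimes> s" by (auto simp: doubleton_eq_iff)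
    then show ?thesis
      by cases (use gen[OF gs(2,3)] in \<open>simp_all add: power2_commute\<close>)
  qed
  have "(\<Sum>h\<in>?V. qform ?V (laplacian ?V ?E w) (\<lambda>g. \<phi> (h \<otimes> g))) = c * card ?E"
    if w: "normalized_weight ?E w" for w
  proof -
    have "(\<Sum>h\<in>?V. qform ?V (laplacian ?V ?E w) (\<lambda>g. \<phi> (h \<otimes> g))) =
        (\<Sum>h\<in>?V. \<Sum>u\<in>?V. \<Sum>v\<in>?V. if {u, v} \<in> ?E then w {u, v} * (\<phi> (h \<otimes> u) - \<phi> (h \<otimes> v))\<^sup>2 else 0) / 2"
      by (simp add: qform_laplacian[OF fin E2] sum_divide_distrib)
    also have "(\<Sum>h\<in>?V. \<Sum>u\<in>?V. \<Sum>v\<in>?V. if {u, v} \<in> ?E then w {u, v} * (\<phi> (h \<otimes> u) - \<phi> (h \<otimes> v))\<^sup>2 else 0) =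
        (\<Sum>u\<in>?V. \<Sum>h\<in>?V. \<Sum>v\<in>?V. if {u, v} \<in> ?E then w {u, v} * (\<phi> (h \<otimes> u) - \<phi> (h \<otimes> v))\<^sup>2 else 0)"
      by (rule sum.swap)
    also have "\<dots> =
        (\<Sum>u\<in>?V. \<Sum>v\<in>?V. \<Sum>h\<in>?V. if {u, v} \<in> ?E then w {u, v} * (\<phi> (h \<otimes> u) - \<phi> (h \<otimes> v))\<^sup>2 else 0)"
      by (intro sum.cong refl sum.swap)
    also have "\<dots> = (\<Sum>u\<in>?V. \<Sum>v\<in>?V. if {u, v} \<in> ?E then c * w {u, v} else 0)"
      by (intro sum.cong) (simp_all add: sum_distrib_left[symmetric] edge)
    also have "\<dots> = 2 * (\<Sum>e\<in>?E. c * w e)"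
      using sum_ordered_edges[OF fin E, of "\<lambda>e. c * w e"] by simp
    finally show ?thesis
      using w by (simp add: normalized_weight_def sum_distrib_left[symmetric])
  qed
  then show ?thesis by blast
qed

text \<open>The constant total is evaluated at the weight \<open>ones\<close>, for which every
  translate has the energy of \<open>\<phi>\<close> itself.\<close>

lemma average_qform_cayley:
  assumes fin: "finite (carrier G)" and S: "S \<subseteq> carrier G" "\<one> \<notin> S"
    and "\<And>s t. s \<in> S \<Longrightarrow> t \<in> S \<Longrightarrow>
      (\<Sum>g\<in>carrier G. \<phi> g * \<phi> (g \<otimes> s)) = (\<Sum>g\<in>carrier G. \<phi> g * \<phi> (g \<otimes> t))"
    and w: "normalized_weight (cayley_edges G S) w"
  shows "(\<Sum>h\<in>carrier G. qform (carrier G) (laplacian (carrier G) (cayley_edges G S) w) (\<lambda>g. \<phi> (h \<otimes> g))) =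
    card (carrier G) * qform (carrier G) (laplacian (carrier G) (cayley_edges G S) ones) \<phi>"
proof -
  have "normalized_weight (cayley_edges G S) ones" by (simp add: normalized_weight_def ones_def)
  then have "(\<Sum>h\<in>carrier G. qform (carrier G) (laplacian (carrier G) (cayley_edges G S) w) (\<lambda>g. \<phi> (h \<otimes> g))) =
      (\<Sum>h\<in>carrier G. qform (carrier G) (laplacian (carrier G) (cayley_edges G S) ones) (\<lambda>g. \<phi> (h \<otimes> g)))"
    using sum_qform_translates[OF fin S assms(4)] w by fastforce
  also have "\<dots> = (\<Sum>h\<in>carrier G. qform (carrier G) (laplacian (carrier G) (cayley_edges G S) ones) \<phi>)"
    using qform_cayley_translate[OF fin S] by (intro sum.cong) simp_all
  finally show ?thesis by simp
qed

text \<open>On a single vertex \<open>\<lambda>\<^sub>2\<close> is an out-of-range list entry, hence unspecified; the existence of an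
  eigenvector for it forces it to be \<open>0\<close>.\<close>

lemma conformally_rigid_trivial_group:
  assumes "card (carrier G) = 1" "S \<subseteq> carrier G" "\<one> \<notin> S"
    and graph: "simple_connected_graph (carrier G) (cayley_edges G S)"
    and e2: "lap_eigenvector (carrier G) (cayley_edges G S) ones \<phi>\<^sub>2
           (lap_eigenvalue (carrier G) (cayley_edges G S) ones 2)"
    and en: "lap_eigenvector (carrier G) (cayley_edges G S) ones \<phi>\<^sub>n
           (lap_eigenvalue (carrier G) (cayley_edges G S) ones (card (carrier G)))"
  shows "conformally_rigid (carrier G) (cayley_edges G S)"
proof -
  let ?V = "carrier G"
  have V: "?V = {\<one>}" using assms(1) by (metis card_1_singletonE one_closed singletonD)
  then have E: "cayley_edges G S = {}" using assms(2,3) by (auto simp: cayley_edges_def)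
  have lap: "laplacian ?V {} w = (\<lambda>u v. 0)" for w by (simp add: laplacian_def fun_eq_iff)
  have const: "lap_eigenvalue ?V {} w k = lap_eigenvalue ?V {} ones k" for w k
    by (simp add: lap_eigenvalue_eq lap)
  have "\<mu> = 0" if "lap_eigenvector ?V {} ones \<phi> \<mu>" for \<mu> \<phi>
    using that by (auto simp: lap_eigenvector_def lap)
  then have zero: "lap_eigenvalue ?V {} ones 2 = 0" "lap_eigenvalue ?V {} ones (card ?V) = 0"
    using e2 en unfolding E by blast+
  have "lap_eigenvalue ?V {} w 2 = 0" "lap_eigenvalue ?V {} w (card ?V) = 0" for w
    using const[of w] zero by metis+
  then show ?thesis
    using graph by (simp add: conformally_rigid_def E)
qed

end

section \<open>Comparison of the extremal eigenvalues\<close>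

theorem theorem3:
  fixes G :: "('a, 'b) monoid_scheme" (structure)
    and S :: "'a set"
    and \<phi>\<^sub>2 \<phi>\<^sub>n :: "'a \<Rightarrow> real"
  assumes "group G"
    and "finite (carrier G)"
    and "S \<subseteq> carrier G"
    and "generate G S = carrier G"
    and "\<And>s. s \<in> S \<Longrightarrow> inv s \<in> S"
    and "\<one> \<notin> S"
    and "lap_eigenvector (carrier G) (cayley_edges G S) ones \<phi>\<^sub>2
           (lap_eigenvalue (carrier G) (cayley_edges G S) ones 2)"
    and "lap_eigenvector (carrier G) (cayley_edges G S) ones \<phi>\<^sub>n
           (lap_eigenvalue (carrier G) (cayley_edges G S) ones (card (carrier G)))"
    and "\<forall>\<phi>\<in>{\<phi>\<^sub>2, \<phi>\<^sub>n}. \<forall>s\<in>S. \<forall>t\<in>S.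
           (\<Sum>g\<in>carrier G. \<phi> g * \<phi> (g \<otimes> s)) = (\<Sum>g\<in>carrier G. \<phi> g * \<phi> (g \<otimes> t))"
  shows "conformally_rigid (carrier G) (cayley_edges G S)"
proof -
  interpret group G by (rule assms(1))
  note fin = assms(2) and S = assms(3) assms(6)
  define V E n where "V = carrier G" and "E = cayley_edges G S" and "n = card V"
  have graph: "simple_connected_graph V E"
    unfolding V_def E_def by (rule simple_connected_cayley_graph[OF assms(2-6)])
  have finV: "finite V" and E2: "\<forall>e\<in>E. card e = 2"
    using graph by (auto simp: simple_connected_graph_def)
  have n: "0 < n" using fin one_closed by (auto simp: n_def V_def card_gt_0_iff)
  show ?thesis
  proof (cases "n = 1")
    case True
    then show ?thesis
      using conformally_rigid_trivial_group[OF _ S _ assms(7,8)] graph by (simp add: n_def V_def E_def)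
  next
    case False
    then have n2: "2 \<le> card V" using n by (simp add: n_def)
    define Q where "Q = (\<lambda>w. qform V (laplacian V E w))"
    define T :: "('a \<Rightarrow> real) \<Rightarrow> 'a \<Rightarrow> 'a \<Rightarrow> real" where "T = (\<lambda>\<phi> h g. \<phi> (h \<otimes> g))"
    have norm_T: "(\<Sum>v\<in>V. (T \<phi> h v)\<^sup>2) = (\<Sum>v\<in>V. (\<phi> v)\<^sup>2)" if "h \<in> V" for h and \<phi> :: "'a \<Rightarrow> real"
      using that sum_left_translation[of h "\<lambda>v. (\<phi> v)\<^sup>2"] by (simp add: T_def V_def)
    have norm_pos: "0 < n * (\<Sum>v\<in>V. (\<phi> v)\<^sup>2)" if "lap_eigenvector V E w \<phi> \<mu>" for w \<mu> and \<phi> :: "'a \<Rightarrow> real"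
    proof -
      obtain z where "z \<in> V" "\<phi> z \<noteq> 0" using \<open>lap_eigenvector V E w \<phi> \<mu>\<close> by (auto simp: lap_eigenvector_def)
      then have "0 < (\<Sum>v\<in>V. (\<phi> v)\<^sup>2)" using finV by (intro sum_pos2[of _ z]) auto
      then show ?thesis using n by simp
    qed
    \<comment> \<open>For every normalized weight, the total energy of the translates is what it
      would be if each translate were an eigenvector for \<open>\<mu>\<close>.\<close>
    have average: "(\<Sum>h\<in>V. Q w (T \<phi> h)) = \<mu> * (n * (\<Sum>v\<in>V. (\<phi> v)\<^sup>2))"
      if "\<phi> \<in> {\<phi>\<^sub>2, \<phi>\<^sub>n}" "lap_eigenvector V E ones \<phi> \<mu>" "normalized_weight E w" for \<mu> w and \<phi> :: "'a \<Rightarrow> real"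
    proof -
      have "Q ones \<phi> = \<mu> * (\<Sum>v\<in>V. (\<phi> v)\<^sup>2)"
        unfolding Q_def using that(2) by (intro qform_eigenvector) (auto simp: lap_eigenvector_def)
      moreover have "(\<Sum>h\<in>V. Q w (T \<phi> h)) = n * Q ones \<phi>"
        unfolding Q_def T_def V_def E_def n_def
      proof (rule average_qform_cayley[OF fin S])
        show "(\<Sum>g\<in>carrier G. \<phi> g * \<phi> (g \<otimes> s)) = (\<Sum>g\<in>carrier G. \<phi> g * \<phi> (g \<otimes> t))"
          if "s \<in> S" "t \<in> S" for s t
          using assms(9) \<open>\<phi> \<in> {\<phi>\<^sub>2, \<phi>\<^sub>n}\<close> that by blast
      qed (use that(3) in \<open>simp add: E_def\<close>)
      ultimately show ?thesis by simp
    qed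
    let ?l = "lap_eigenvalue V E"
    have ev2: "lap_eigenvector V E ones \<phi>\<^sub>2 (?l ones 2)" and evn: "lap_eigenvector V E ones \<phi>\<^sub>n (?l ones n)"
      using assms(7,8) by (simp_all add: V_def E_def n_def)
    \<comment> \<open>Summing the eigenvalue equation over all vertices gives 0, since the Laplacian
      has zero column sums; the eigenvalue is positive and cancels.\<close>
    have "(\<Sum>v\<in>V. \<phi>\<^sub>2 v) = 0"
    proof -
      have "?l ones 2 * (\<Sum>v\<in>V. \<phi>\<^sub>2 v) = (\<Sum>u\<in>V. \<Sum>v\<in>V. laplacian V E ones u v * \<phi>\<^sub>2 v)"
        using ev2 by (simp add: lap_eigenvector_def sum_distrib_left)
      also have "\<dots> = (\<Sum>v\<in>V. (\<Sum>u\<in>V. laplacian V E ones v u) * \<phi>\<^sub>2 v)"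
        by (subst sum.swap) (simp add: sum_distrib_right laplacian_sym)
      also have "\<dots> = 0" using laplacian_row_sum[OF finV E2] by simp
      finally show ?thesis using lap_eigenvalue_2_pos[OF graph n2] by simp
    qed
    then have sum_T: "(\<Sum>v\<in>V. T \<phi>\<^sub>2 h v) = 0" if "h \<in> V" for h
      using that sum_left_translation[of h \<phi>\<^sub>2] by (simp add: T_def V_def)
    \<comment> \<open>Each translate of \<open>\<phi>\<^sub>2\<close> has sum zero and is a test
      vector for the second eigenvalue of \<open>w\<close>. The inequalities are added over
      \<open>h\<close>, and the positive total norm cancels.\<close>
    have "?l w 2 \<le> ?l ones 2" if w: "normalized_weight E w" for w
    proof -
      have "?l w 2 * (n * (\<Sum>v\<in>V. (\<phi>\<^sub>2 v)\<^sup>2)) = (\<Sum>h\<in>V. ?l w 2 * (\<Sum>v\<in>V. (T \<phi>\<^sub>2 h v)\<^sup>2))"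
        by (simp add: norm_T n_def)
      also have "\<dots> \<le> (\<Sum>h\<in>V. Q w (T \<phi>\<^sub>2 h))"
      proof (rule sum_mono)
        fix h assume h: "h \<in> V"
        have "0 \<le> qform V (laplacian V E w) (T \<phi>\<^sub>2 h)"
          using w by (intro qform_laplacian_nonneg[OF finV E2]) (simp add: normalized_weight_def)
        then show "?l w 2 * (\<Sum>v\<in>V. (T \<phi>\<^sub>2 h v)\<^sup>2) \<le> Q w (T \<phi>\<^sub>2 h)"
          using second_eigenvalue_le_qform[OF finV laplacian_sym n2 laplacian_row_sum[OF finV E2] sum_T[OF h]]
          by (simp add: lap_eigenvalue_eq Q_def)
      qed
      also have "\<dots> = ?l ones 2 * (n * (\<Sum>v\<in>V. (\<phi>\<^sub>2 v)\<^sup>2))"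
        using average[OF _ ev2 w] by simp
      finally show ?thesis using norm_pos[OF ev2] by (simp add: mult_le_cancel_right)
    qed
    \<comment> \<open>The same averaging with the upper bound, which holds for every test vector and
      thus asks for no orthogonality.\<close>
    moreover have "?l ones n \<le> ?l w n" if w: "normalized_weight E w" for w
    proof -
      have "?l ones n * (n * (\<Sum>v\<in>V. (\<phi>\<^sub>n v)\<^sup>2)) = (\<Sum>h\<in>V. Q w (T \<phi>\<^sub>n h))"
        using average[OF _ evn w] by simp
      also have "\<dots> \<le> (\<Sum>h\<in>V. ?l w n * (\<Sum>v\<in>V. (T \<phi>\<^sub>n h v)\<^sup>2))"
        unfolding Q_def lap_eigenvalue_eq n_def
        by (intro sum_mono qform_le_largest_eigenvalue[OF finV] laplacian_sym)
      also have "\<dots> = ?l w n * (n * (\<Sum>v\<in>V. (\<phi>\<^sub>n v)\<^sup>2))"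
        by (simp add: norm_T n_def)
      finally show ?thesis using norm_pos[OF evn] by (simp add: mult_le_cancel_right)
    qed
    moreover have "?l ones 2 \<le> ?l ones n"
      unfolding lap_eigenvalue_eq using n2 n_def
        spectral_theorem_symmetric(1)[of V "laplacian V E ones", OF finV laplacian_sym]
      by (intro sorted_nth_mono[OF sorted_eigenvalue_list]) auto
    ultimately show ?thesis
      using graph by (simp add: conformally_rigid_def V_def[symmetric] E_def[symmetric] n_def)
  qed
qed

end
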